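(* Let $G$ be a graph with $n=|V(G)|\ge 2$ and let $P_r$ be the path on $r\ge 3$ vertices. Then: (1) $\mu_k(P_r\odot G)=(k-1)n+2$ for every integer $k$ with $2\le k\le r-1$; (2) $\mu_r(P_r\odot G)=(r-1)n+1$; (3) $\mu_{r+1}(P_r\odot G)=\mu(P_r\odot G)=rn$.
   Context: The corona graph $G\odot H$ is obtained from one copy of $G$ and $|V(G)|$ copies of $H$ by joining the $i$th vertex of $G$ to every vertex of the $i$th copy of $H$. For a graph $G$, a set $S\subseteq V(G)$ and an integer $k\ge 1$, two vertices $x,y$ are $S_k$-visible if there is a shortest $x,y$-path of length at most $k$ none of whose internal vertices lies in $S$. $S$ is a $k$-distance mutual-visibility set if every two vertices of $S$ are $S_k$-visible, and $\mu_k(G)$ is the maximum cardinality of such a set. Two vertices $x,y\in S$ are $S$-visible if there is a shortest $x,y$-path $P$ with $V(P)\cap S=\{x,y\}$; $\mu(G)$ is the maximum cardinality of a set $S$ in which every two vertices are $S$-visible. *)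

theory Defs
  imports "Graph_Theory.Graph_Theory"
begin

text \<open>
  Finite simple graphs are symmetric loop-free finite digraphs whose arcs are pairs of vertices
  (locale \<^locale>\<open>pair_graph\<close>): an edge is a pair of mutually inverse arcs. Paths are
  lists of distinct vertices (\<^const>\<open>vpath\<close>).
\<close>

definition path_graph :: "nat \<Rightarrow> nat pair_pre_digraph" where
  "path_graph r = \<lparr> pverts = {..<r}, parcs = {(i, j). i < r \<and> j < r \<and> (j = Suc i \<or> i = Suc j)} \<rparr>"

text \<open>
  \<open>Inl u\<close> is the vertex \<open>u\<close> of \<open>G\<close>; \<open>Inr (u, x)\<close> is the vertex \<open>x\<close> of the copy of \<open>H\<close>
  attached to \<open>u\<close>.
\<close>

definition corona ::
  "'a pair_pre_digraph \<Rightarrow> 'b pair_pre_digraph \<Rightarrow> ('a + 'a \<times> 'b) pair_pre_digraph" where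
  "corona G H = \<lparr>
     pverts = Inl ` pverts G \<union> Inr ` (pverts G \<times> pverts H),
     parcs = {(Inl u, Inl v) | u v. (u, v) \<in> parcs G}
           \<union> {(Inr (u, x), Inr (u, y)) | u x y. u \<in> pverts G \<and> (x, y) \<in> parcs H}
           \<union> {(Inl u, Inr (u, x)) | u x. u \<in> pverts G \<and> x \<in> pverts H}
           \<union> {(Inr (u, x), Inl u) | u x. u \<in> pverts G \<and> x \<in> pverts H} \<rparr>"

definition path_between :: "'a pair_pre_digraph \<Rightarrow> 'a \<Rightarrow> 'a \<Rightarrow> 'a list \<Rightarrow> bool" where
  "path_between G x y p \<longleftrightarrow> vpath p (with_proj G) \<and> hd p = x \<and> last p = y"

definition shortest_path :: "'a pair_pre_digraph \<Rightarrow> 'a \<Rightarrow> 'a \<Rightarrow> 'a list \<Rightarrow> bool" where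
  "shortest_path G x y p \<longleftrightarrow>
     path_between G x y p \<and> (\<forall>q. path_between G x y q \<longrightarrow> vwalk_length p \<le> vwalk_length q)"

text \<open>The internal vertices of a path \<open>p\<close> are those of \<open>butlast (tl p)\<close>.\<close>

definition k_visible :: "'a pair_pre_digraph \<Rightarrow> 'a set \<Rightarrow> nat \<Rightarrow> 'a \<Rightarrow> 'a \<Rightarrow> bool" where
  "k_visible G S k x y \<longleftrightarrow>
     (\<exists>p. shortest_path G x y p \<and> vwalk_length p \<le> k \<and> set (butlast (tl p)) \<inter> S = {})"

definition k_distance_mutual_visibility_set :: "'a pair_pre_digraph \<Rightarrow> nat \<Rightarrow> 'a set \<Rightarrow> bool" where
  "k_distance_mutual_visibility_set G k S \<longleftrightarrow>
     S \<subseteq> pverts G \<and> (\<forall>x\<in>S. \<forall>y\<in>S. x \<noteq> y \<longrightarrow> k_visible G S k x y)"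

definition mu_k :: "nat \<Rightarrow> 'a pair_pre_digraph \<Rightarrow> nat" where
  "mu_k k G = Max (card ` {S. k_distance_mutual_visibility_set G k S})"

definition visible :: "'a pair_pre_digraph \<Rightarrow> 'a set \<Rightarrow> 'a \<Rightarrow> 'a \<Rightarrow> bool" where
  "visible G S x y \<longleftrightarrow> (\<exists>p. shortest_path G x y p \<and> set p \<inter> S = {x, y})"

definition mutual_visibility_set :: "'a pair_pre_digraph \<Rightarrow> 'a set \<Rightarrow> bool" where
  "mutual_visibility_set G S \<longleftrightarrow>
     S \<subseteq> pverts G \<and> (\<forall>x\<in>S. \<forall>y\<in>S. x \<noteq> y \<longrightarrow> visible G S x y)"

definition mu :: "'a pair_pre_digraph \<Rightarrow> nat" where
  "mu G = Max (card ` {S. mutual_visibility_set G S})"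

lemma pair_graph_path_graph: "pair_graph (path_graph r)"
proof -
  have "parcs (path_graph r) \<subseteq> {..<r} \<times> {..<r}"
    by (auto simp: path_graph_def)
  then have "finite (parcs (path_graph r))"
    by (rule finite_subset) auto
  then show ?thesis
    by unfold_locales (auto simp: path_graph_def symmetric_def sym_def)
qed

lemma pair_graph_corona:
  assumes "pair_graph G" and "pair_graph H"
  shows "pair_graph (corona G H)"
proof -
  interpret G: pair_graph G by fact
  interpret H: pair_graph H by fact
  have symG: "(v, u) \<in> parcs G" if "(u, v) \<in> parcs G" for u v
    using G.sym_arcs that by (auto simp: symmetric_def sym_def)
  have symH: "(v, u) \<in> parcs H" if "(u, v) \<in> parcs H" for u v
    using H.sym_arcs that by (auto simp: symmetric_def sym_def)
  have fin: "finite (pverts (corona G H))"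
    by (simp add: corona_def G.pair_finite_verts H.pair_finite_verts)
  have sub: "parcs (corona G H) \<subseteq> pverts (corona G H) \<times> pverts (corona G H)"
    by (auto simp: corona_def dest: G.wellformed' H.wellformed')
  have "finite (parcs (corona G H))"
    by (rule finite_subset[OF sub]) (simp add: fin)
  moreover have "symmetric (with_proj (corona G H))"
    unfolding symmetric_def sym_def by (auto simp: corona_def intro: symG symH)
  moreover have "fst e \<noteq> snd e" if "e \<in> parcs (corona G H)" for e
    using that by (auto simp: corona_def dest: G.pair_no_loops H.pair_no_loops)
  ultimately show ?thesis
    using fin sub by unfold_locales auto
qed

text \<open>The maxima in \<^const>\<open>mu_k\<close> and \<^const>\<open>mu\<close> range over finite nonempty sets.\<close>

lemma mu_k_max_wellformed:
  assumes "finite (pverts G)"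
  shows "finite (card ` {S. k_distance_mutual_visibility_set G k S})"
    and "card ` {S. k_distance_mutual_visibility_set G k S} \<noteq> {}"
proof -
  have "{S. k_distance_mutual_visibility_set G k S} \<subseteq> Pow (pverts G)"
    by (auto simp: k_distance_mutual_visibility_set_def)
  then show "finite (card ` {S. k_distance_mutual_visibility_set G k S})"
    using assms by (meson finite_Pow_iff finite_imageI finite_subset)
  have "k_distance_mutual_visibility_set G k {}"
    by (simp add: k_distance_mutual_visibility_set_def)
  then show "card ` {S. k_distance_mutual_visibility_set G k S} \<noteq> {}"
    by blast
qed

lemma mu_max_wellformed:
  assumes "finite (pverts G)"
  shows "finite (card ` {S. mutual_visibility_set G S})"
    and "card ` {S. mutual_visibility_set G S} \<noteq> {}"
proof -
  have "{S. mutual_visibility_set G S} \<subseteq> Pow (pverts G)"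
    by (auto simp: mutual_visibility_set_def)
  then show "finite (card ` {S. mutual_visibility_set G S})"
    using assms by (meson finite_Pow_iff finite_imageI finite_subset)
  have "mutual_visibility_set G {}"
    by (simp add: mutual_visibility_set_def)
  then show "card ` {S. mutual_visibility_set G S} \<noteq> {}"
    by blast
qed

end

theory Submission
  imports Defs
begin

text \<open>
  Every spine vertex \<open>Inl i\<close> of \<open>corona (path_graph r) H\<close> is a cut vertex: a path between
  vertices over positions \<open>u < v\<close> runs through \<open>Inl u, \<dots>, Inl v\<close>, and a shortest one meets
  nothing else besides its ends. Hence a mutual-visibility set contains at most two spine vertices;
  one spine vertex forces some copy of \<open>H\<close> to be missed, and two of them force all copies met
  to lie strictly in between. Bounding distances by \<open>k\<close> confines the copies met to \<open>k - 1\<close>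
  consecutive positions. The extremal sets are unions of consecutive copies of \<open>H\<close>, flanked by
  as many spine vertices as fit.
\<close>

section \<open>Paths in symmetric graphs\<close>

lemma vwalk_append:
  assumes "vwalk p G" and "vwalk q G" and "(last p, hd q) \<in> arcs_ends G"
  shows "vwalk (p @ q) G"
  using assms by (auto simp: vwalk_def vwalk_arcs_append)

lemma (in sym_digraph) vwalk_rev:
  assumes "vwalk p G"
  shows "vwalk (rev p) G"
  using assms
proof (induction p rule: vwalk_induct)
  case (Base u)
  then show ?case by (auto simp: vwalk_def)
next
  case (Cons u v es)
  have "vwalk (rev (v # es) @ [u]) G"
  proof (rule vwalk_append)
    have "u \<in> verts G"
      using Cons(1) by (rule adj_in_verts)
    then show "vwalk [u] G"
      by (auto simp: vwalk_def)
    show "(last (rev (v # es)), hd [u]) \<in> arcs_ends G"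
      using Cons(1) sym_arcs by (auto simp: symmetric_def dest: symD)
  qed (use Cons in auto)
  then show ?case by simp
qed

lemma (in pair_graph) path_between_rev:
  assumes "path_between G x y p"
  shows "path_between G y x (rev p)"
  using assms vwalk_rev by (auto simp: path_between_def vpath_def hd_rev last_rev)

text \<open>Reversal maps shortest paths to shortest paths and keeps the internal vertices. Later
  only pairs ordered along the spine need to be treated.\<close>

lemma (in pair_graph) k_visible_sym:
  assumes "k_visible G S k x y"
  shows "k_visible G S k y x"
proof -
  obtain p where p: "shortest_path G x y p" "vwalk_length p \<le> k" "set (butlast (tl p)) \<inter> S = {}"
    using assms by (auto simp: k_visible_def)
  have "vwalk_length (rev p) \<le> vwalk_length q" if "path_between G y x q" for q
    using p(1) path_between_rev[OF that] by (fastforce simp: shortest_path_def)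
  then have "shortest_path G y x (rev p)"
    using p(1) path_between_rev by (auto simp: shortest_path_def)
  moreover have "butlast (tl (rev p)) = rev (butlast (tl p))"
    by (metis butlast_rev butlast_tl rev_rev_ident)
  ultimately show ?thesis
    using p unfolding k_visible_def by (intro exI[of _ "rev p"]) auto
qed

section \<open>Internal vertices of a path, and the two notions of visibility\<close>

lemma set_butlast_tl_path:
  assumes "path_between G x y p" and "x \<noteq> y"
  shows "set (butlast (tl p)) = set p - {x, y}"
proof -
  have p: "distinct p" "p \<noteq> []" "hd p = x" "last p = y"
    using assms by (auto simp: path_between_def vpath_def vwalk_def)
  then obtain q where q: "p = x # q"
    by (cases p) auto
  with p assms(2) have "q \<noteq> []" "last q = y"
    by auto
  then obtain q' where "q = q' @ [y]"
    by (metis append_butlast_last_id)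
  then show ?thesis
    using q p by auto
qed

lemma shortest_path_visible:
  assumes "shortest_path G x y p" and "x \<noteq> y" and "x \<in> S" and "y \<in> S"
  shows "set (butlast (tl p)) \<inter> S = {} \<longleftrightarrow> set p \<inter> S = {x, y}"
proof -
  have p: "path_between G x y p"
    using assms(1) by (simp add: shortest_path_def)
  then have "x \<in> set p" "y \<in> set p"
    by (auto simp: path_between_def vpath_def vwalk_def)
  then show ?thesis
    using set_butlast_tl_path[OF p assms(2)] assms(3,4) by auto
qed

lemma two_le_length_path:
  assumes "path_between G x y q" and "x \<noteq> y"
  shows "2 \<le> length q" and "length q = 2 \<Longrightarrow> (x, y) \<in> parcs G"
  using assms
  by (cases q rule: vwalk_arcs.cases; auto simp: path_between_def vpath_def vwalk_def)+

text \<open>Dropping the length bound leaves plain mutual visibility, so every obstruction found for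
  mutual-visibility sets also limits the \<open>k\<close>-distance ones.\<close>

lemma k_distance_imp_mutual_visibility_set:
  assumes "k_distance_mutual_visibility_set G k S"
  shows "mutual_visibility_set G S"
  using assms shortest_path_visible
  unfolding k_distance_mutual_visibility_set_def mutual_visibility_set_def k_visible_def visible_def
  by metis

lemma mu_k_eqI:
  assumes "finite (pverts G)" and "k_distance_mutual_visibility_set G k S" and "card S = m"
    and "\<And>T. k_distance_mutual_visibility_set G k T \<Longrightarrow> card T \<le> m"
  shows "mu_k k G = m"
  unfolding mu_k_def using mu_k_max_wellformed(1)[OF assms(1)] assms(2-) by (intro Max_eqI) auto

lemma mu_eqI:
  assumes "finite (pverts G)" and "mutual_visibility_set G S" and "card S = m"
    and "\<And>T. mutual_visibility_set G T \<Longrightarrow> card T \<le> m"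
  shows "mu G = m"
  unfolding mu_def using mu_max_wellformed(1)[OF assms(1)] assms(2-) by (intro Max_eqI) auto

section \<open>Shortest paths in the corona of a path\<close>

text \<open>The projection of the corona onto the path: a vertex of a copy is sent to the spine
  vertex it hangs from.\<close>

fun position :: "nat + nat \<times> 'a \<Rightarrow> nat" where
  "position (Inl i) = i"
| "position (Inr (i, a)) = i"

text \<open>What has to be added to a spine segment to reach the given end; its length is the
  distance from the vertex to the spine.\<close>

fun stem :: "nat + nat \<times> 'a \<Rightarrow> (nat + nat \<times> 'a) list" where
  "stem (Inl i) = []"
| "stem (Inr (i, a)) = [Inr (i, a)]"

text \<open>The canonical route: down to the spine, along it, and up again. It is meant for
  \<open>position x <= position y\<close>; for two vertices of one copy it is the detour of length 2
  through their spine vertex.\<close>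

definition spine_path :: "nat + nat \<times> 'a \<Rightarrow> nat + nat \<times> 'a \<Rightarrow> (nat + nat \<times> 'a) list" where
  "spine_path x y = stem x @ map Inl [position x..<Suc (position y)] @ stem y"

lemma set_spine_path:
  assumes "position x \<le> position y"
  shows "set (spine_path x y) = {x, y} \<union> Inl ` {position x..position y}"
  using assms unfolding spine_path_def
  by (cases x rule: position.cases; cases y rule: position.cases) auto

lemma length_spine_path:
  assumes "position x \<le> position y"
  shows "length (spine_path x y) =
    length (stem x) + length (stem y) + Suc (position y - position x)"
  using assms by (simp add: spine_path_def)

lemma distinct_spine_path:
  assumes "x \<noteq> y"
  shows "distinct (spine_path x y)"
  using assms unfolding spine_path_def
  by (cases x rule: position.cases; cases y rule: position.cases) (auto simp: distinct_map)

locale path_corona = H: pair_graph H for H :: "'a pair_pre_digraph" +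
  fixes r :: nat
begin

abbreviation C :: "(nat + nat \<times> 'a) pair_pre_digraph" where
  "C \<equiv> corona (path_graph r) H"

sublocale C: pair_graph C
  by (intro pair_graph_corona pair_graph_path_graph H.pair_graph_axioms)

lemma pverts_C: "pverts C = Inl ` {..<r} \<union> Inr ` ({..<r} \<times> pverts H)"
  by (simp add: corona_def path_graph_def)

lemma position_less: "x \<in> pverts C \<Longrightarrow> position x < r"
  by (auto simp: pverts_C)

lemma arc_cases:
  assumes "(x, y) \<in> parcs C"
  shows "position x = position y \<or> x = Inl (position x) \<and> y = Inl (position y) \<and>
    (position y = Suc (position x) \<or> position x = Suc (position y))"
  using assms by (auto simp: corona_def path_graph_def)

text \<open>A discrete intermediate value argument: positions change only along spine arcs, by one
  each time. The strict inequality matters, since a walk inside one copy can avoid the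
  spine.\<close>

lemma vwalk_crosses:
  assumes "vwalk p (with_proj C)"
    and "position (hd p) < position (last p)" and "position (hd p) \<le> i" "i \<le> position (last p)"
  shows "Inl i \<in> set p"
  using assms
proof (induction p rule: vwalk_induct)
  case (Base u)
  then show ?case by simp
next
  case (Cons u v es)
  have arc: "(u, v) \<in> parcs C"
    using Cons(1) by simp
  let ?l = "position (last (v # es))"
  have IH: "Inl i \<in> set (v # es)" if "position v < ?l" "position v \<le> i"
    using Cons that by auto
  have l: "position u < ?l" "position u \<le> i" "i \<le> ?l"
    using Cons by auto
  from arc_cases[OF arc] consider
      "position u = position v"
    | "u = Inl (position u)" "v = Inl (position v)" "position v = Suc (position u)"
    | "position u = Suc (position v)"
    by blast
  then show ?case
  proof cases
    case 2
    show ?thesis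
    proof (cases "i = position u")
      case True
      with 2 show ?thesis by (metis list.set_intros(1))
    next
      case False
      show ?thesis
      proof (cases "position v < ?l")
        case True
        then show ?thesis using IH 2 l False by simp
      next
        case False
        then have "i = position v"
          using \<open>i \<noteq> position u\<close> 2(3) l by linarith
        with 2 show ?thesis by (metis list.set_intros)
      qed
    qed
  \<comment> \<open>In the other two cases the step does not raise the position, so the induction
    hypothesis applies to the same \<open>i\<close>.\<close>
  qed (use IH l in auto)
qed

lemma path_between_spine_path:
  assumes "x \<in> pverts C" and "y \<in> pverts C" and "x \<noteq> y" and "position x \<le> position y"
  shows "path_between C x y (spine_path x y)"
proof -
  define m where "m = (map Inl [position x..<Suc (position y)] :: (nat + nat \<times> 'a) list)"
  have spine: "vwalk (map Inl [i..<Suc j]) (with_proj C)" if "i \<le> j" "j < r" for i j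
    using that
  proof (induction j)
    case 0
    then show ?case by (auto simp: vwalk_def pverts_C)
  next
    case (Suc j)
    show ?case
    proof (cases "i = Suc j")
      case True
      then show ?thesis using Suc by (auto simp: vwalk_def pverts_C)
    next
      case False
      then have "vwalk (map Inl [i..<Suc j] @ [Inl (Suc j)]) (with_proj C)"
        using Suc by (intro vwalk_append)
          (auto simp: vwalk_def pverts_C last_map corona_def path_graph_def)
      then show ?thesis using False Suc by simp
    qed
  qed
  have m: "vwalk m (with_proj C)" "m \<noteq> []" "hd m = Inl (position x)" "last m = Inl (position y)"
    using spine assms(4) position_less[OF assms(2)] by (simp_all add: m_def hd_append hd_map)
  have my: "vwalk (m @ stem y) (with_proj C)" "last (m @ stem y) = y" "hd (m @ stem y) = Inl (position x)"
  proof -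
    show "hd (m @ stem y) = Inl (position x)"
      using m by simp
    show "last (m @ stem y) = y"
      using m by (cases y rule: position.cases) auto
    show "vwalk (m @ stem y) (with_proj C)"
    proof (cases y rule: position.cases)
      case (2 i a)
      then have "(Inl i, y) \<in> parcs C"
        using assms(2) by (auto simp: corona_def path_graph_def)
      then show ?thesis
        using m 2 assms(2) by (intro vwalk_append) (auto simp: vwalk_def)
    qed (use m in auto)
  qed
  have "vwalk (stem x @ m @ stem y) (with_proj C)" "hd (stem x @ m @ stem y) = x"
  proof -
    show "hd (stem x @ m @ stem y) = x"
      using m by (cases x rule: position.cases) auto
    show "vwalk (stem x @ m @ stem y) (with_proj C)"
    proof (cases x rule: position.cases)
      case (2 i a)
      then have "(x, Inl i) \<in> parcs C"
        using assms(1) by (auto simp: corona_def path_graph_def)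
      then show ?thesis
        using my(1,3) 2 assms(1) by (simp add: vwalk_consI)
    qed (use my in auto)
  qed
  moreover have "last (stem x @ m @ stem y) = y"
    using my m(2) by simp
  ultimately show ?thesis
    using distinct_spine_path[OF assms(3)]
    by (simp add: path_between_def vpath_def spine_path_def m_def)
qed

text \<open>Every path crosses all spine vertices from one position to the other. This gives both
  the minimality of \<open>spine_path\<close> and the obstruction to visibility.\<close>

lemma set_spine_path_subset:
  assumes "path_between C x y q" and "position x < position y"
  shows "set (spine_path x y) \<subseteq> set q"
proof -
  have q: "vwalk q (with_proj C)" "hd q = x" "last q = y" "q \<noteq> []"
    using assms(1) by (auto simp: path_between_def vpath_def vwalk_def)
  then have "Inl i \<in> set q" if "i \<in> {position x..position y}" for i
    using vwalk_crosses[of q i] assms(2) that by auto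
  then show ?thesis
    using q assms(2) by (auto simp: set_spine_path)
qed

lemma length_spine_path_le:
  assumes "path_between C x y q" and "position x < position y"
  shows "length (spine_path x y) \<le> length q"
proof -
  have "distinct (spine_path x y)"
    using assms(2) by (intro distinct_spine_path) auto
  then have "length (spine_path x y) = card (set (spine_path x y))"
    by (simp add: distinct_card)
  also have "\<dots> \<le> card (set q)"
    by (intro card_mono set_spine_path_subset assms) simp
  also have "\<dots> \<le> length q"
    by (rule card_length)
  finally show ?thesis .
qed

text \<open>The spine path is the witness unless \<open>x\<close> and \<open>y\<close> are adjacent.
  The sum bounded by \<open>k\<close> is its number of edges, and its internal vertices are all on
  the spine.\<close>

lemma k_visibleI:
  assumes "x \<in> pverts C" and "y \<in> pverts C" and "x \<noteq> y" and "position x \<le> position y"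
    and spine: "\<And>i. position x \<le> i \<Longrightarrow> i \<le> position y \<Longrightarrow> Inl i \<in> S \<Longrightarrow> Inl i \<in> {x, y}"
    and "length (stem x) + length (stem y) + (position y - position x) \<le> k"
  shows "k_visible C S k x y"
proof (cases "(x, y) \<in> parcs C")
  \<comment> \<open>Inside a copy the spine path has length 2, so adjacent vertices need the edge
    itself.\<close>
  case True
  then have "path_between C x y [x, y]"
    using assms(1-3) by (auto simp: path_between_def vpath_def vwalk_def)
  then have "shortest_path C x y [x, y]"
    using two_le_length_path(1) assms(3) by (fastforce simp: shortest_path_def)
  \<comment> \<open>Distinct vertices at the same position cannot both be on the spine, so the sum
    bounded by \<open>k\<close> is positive.\<close>
  moreover have "1 \<le> k"
    using assms(3,4,6) by (cases x rule: position.cases; cases y rule: position.cases) auto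
  ultimately show ?thesis
    unfolding k_visible_def by (intro exI[of _ "[x, y]"]) auto
next
  case False
  let ?p = "spine_path x y"
  have p: "path_between C x y ?p"
    by (intro path_between_spine_path assms)
  have "length ?p \<le> length q" if q: "path_between C x y q" for q
  proof (cases "position x < position y")
    case True
    with q show ?thesis by (rule length_spine_path_le)
  next
    \<comment> \<open>At equal positions the spine path has at most three vertices, and non-adjacent
      ends force three on any path.\<close>
    case same: False
    have "length ?p \<le> 3"
      using assms(4) same by (cases x rule: position.cases; cases y rule: position.cases)
        (auto simp: length_spine_path)
    moreover have "3 \<le> length q"
      using two_le_length_path[OF q assms(3)] False by fastforce
    ultimately show ?thesis by linarith
  qed
  then have "shortest_path C x y ?p"
    using p by (fastforce simp: shortest_path_def)
  moreover have "vwalk_length ?p \<le> k"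
    using assms(4,6) by (simp add: length_spine_path)
  moreover have "set (butlast (tl ?p)) \<inter> S = {}"
  proof -
    have "z \<notin> S" if "z \<in> set (butlast (tl ?p))" for z
    proof -
      have "z \<in> Inl ` {position x..position y}" "z \<notin> {x, y}"
        using that unfolding set_butlast_tl_path[OF p assms(3)] set_spine_path[OF assms(4)] by auto
      then obtain i where "z = Inl i" "position x \<le> i" "i \<le> position y" "Inl i \<notin> {x, y}"
        by auto
      then show ?thesis
        using spine by metis
    qed
    then show ?thesis by blast
  qed
  ultimately show ?thesis
    unfolding k_visible_def by blast
qed

lemma k_distance_mutual_visibility_setI:
  assumes "S \<subseteq> pverts C"
    and "\<And>x y i. x \<in> S \<Longrightarrow> y \<in> S \<Longrightarrow> x \<noteq> y \<Longrightarrow> position x \<le> i \<Longrightarrow> i \<le> position y \<Longrightarrow>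
      Inl i \<in> S \<Longrightarrow> Inl i \<in> {x, y}"
    and "\<And>x y. x \<in> S \<Longrightarrow> y \<in> S \<Longrightarrow> x \<noteq> y \<Longrightarrow> position x \<le> position y \<Longrightarrow>
      length (stem x) + length (stem y) + (position y - position x) \<le> k"
  shows "k_distance_mutual_visibility_set C k S"
proof -
  have le: "k_visible C S k x y" if "x \<in> S" "y \<in> S" "x \<noteq> y" "position x \<le> position y" for x y
    using that assms by (intro k_visibleI) blast+
  have "k_visible C S k x y" if "x \<in> S" "y \<in> S" "x \<noteq> y" for x y
    using le[of x y] le[of y x] C.k_visible_sym that by (cases "position x \<le> position y") auto
  then show ?thesis
    using assms(1) by (simp add: k_distance_mutual_visibility_set_def)
qed

section \<open>Upper bounds\<close>

text \<open>The basic obstruction: every path from \<open>x\<close> to \<open>y\<close> runs through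
  \<open>Inl i\<close>, so if \<open>Inl i\<close> is in \<open>S\<close> it must be an end.\<close>

lemma spine_vertex_not_between:
  assumes "mutual_visibility_set C S" and "x \<in> S" and "y \<in> S"
    and "position x < position y" and "position x \<le> i" and "i \<le> position y" and "Inl i \<in> S"
  shows "Inl i \<in> {x, y}"
proof -
  have "x \<noteq> y"
    using assms(4) by auto
  then have "visible C S x y"
    using assms(1-3) by (simp add: mutual_visibility_set_def)
  then obtain p where p: "path_between C x y p" "set p \<inter> S = {x, y}"
    unfolding visible_def shortest_path_def by blast
  have "Inl i \<in> set (spine_path x y)"
    using assms(4-6) by (simp add: set_spine_path)
  then show ?thesis
    using set_spine_path_subset[OF p(1) assms(4)] p(2) assms(7) by blast
qed

definition spine_part :: "(nat + nat \<times> 'a) set \<Rightarrow> nat set" where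
  "spine_part S = {i. Inl i \<in> S}"

text \<open>Only the positions of the copies met are recorded; for the upper bounds each such copy
  may be counted in full.\<close>

definition copy_part :: "(nat + nat \<times> 'a) set \<Rightarrow> nat set" where
  "copy_part S = {u. \<exists>a. Inr (u, a) \<in> S}"

lemma parts_subset:
  assumes "S \<subseteq> pverts C"
  shows "spine_part S \<subseteq> {..<r}" and "copy_part S \<subseteq> {..<r}"
  using assms by (auto simp: spine_part_def copy_part_def pverts_C)

lemma card_le_parts:
  assumes "S \<subseteq> pverts C"
  shows "card S \<le> card (spine_part S) + card (copy_part S) * card (pverts H)"
proof -
  have fin: "finite (spine_part S)" "finite (copy_part S)"
    using parts_subset[OF assms] finite_subset by blast+
  have "S \<subseteq> Inl ` spine_part S \<union> Inr ` (copy_part S \<times> pverts H)"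
  proof
    fix x assume "x \<in> S"
    with assms show "x \<in> Inl ` spine_part S \<union> Inr ` (copy_part S \<times> pverts H)"
      by (cases x rule: position.cases) (auto simp: spine_part_def copy_part_def pverts_C)
  qed
  then have "card S \<le> card (Inl ` spine_part S \<union> Inr ` (copy_part S \<times> pverts H) :: (nat + nat \<times> 'a) set)"
    using fin by (intro card_mono) (auto simp: H.pair_finite_verts)
  also have "\<dots> \<le> card (Inl ` spine_part S :: (nat + nat \<times> 'a) set)
      + card (Inr ` (copy_part S \<times> pverts H) :: (nat + nat \<times> 'a) set)"
    by (rule card_Un_le)
  also have "\<dots> = card (spine_part S) + card (copy_part S) * card (pverts H)"
    by (simp add: card_image card_cartesian_product)
  finally show ?thesis .
qed

text \<open>Of three spine vertices, the middle one lies on every path between the outer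
  two.\<close>

lemma spine_part_le_2:
  assumes "mutual_visibility_set C S"
  shows "card (spine_part S) \<le> 2"
proof (rule ccontr)
  let ?A = "spine_part S"
  assume "\<not> ?thesis"
  then have big: "3 \<le> card ?A" by simp
  have fin: "finite ?A"
    using big card.infinite by fastforce
  \<comment> \<open>The leftmost spine vertex is one outer vertex; any two others
    \<open>i < j\<close> supply the middle and the right one.\<close>
  have Min: "Min ?A \<in> ?A"
    using big fin by (intro Min_in) auto
  then have "Suc 0 < card (?A - {Min ?A})"
    using big by (simp add: card_Diff_singleton)
  moreover have "finite (?A - {Min ?A})" using fin by simp
  ultimately obtain i j where ij: "i \<in> ?A - {Min ?A}" "j \<in> ?A - {Min ?A}" "i < j"
    by (metis One_nat_def card_le_Suc0_iff_eq linorder_neqE_nat not_less)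
  then have "Min ?A < i"
    using fin by (auto simp: order.strict_iff_order)
  then have "(Inl i :: nat + nat \<times> 'a) \<in> {Inl (Min ?A), Inl j}"
    using ij Min by (intro spine_vertex_not_between[OF assms]) (auto simp: spine_part_def)
  then show False
    using ij by auto
qed

text \<open>A copy vertex at a position \<open>u <= i\<close> is cut off from \<open>Inl j\<close>
  by \<open>Inl i\<close>; for \<open>j <= u\<close> the roles of \<open>i\<close> and
  \<open>j\<close> are exchanged.\<close>

lemma copy_part_between_spine:
  assumes "mutual_visibility_set C S"
    and "i \<in> spine_part S" and "j \<in> spine_part S" and "i < j"
  shows "copy_part S \<subseteq> {i<..<j}"
proof
  fix u assume "u \<in> copy_part S"
  then obtain a where a: "Inr (u, a) \<in> S"
    by (auto simp: copy_part_def)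
  have S: "Inl i \<in> S" "Inl j \<in> S"
    using assms by (auto simp: spine_part_def)
  show "u \<in> {i<..<j}"
    using spine_vertex_not_between[OF assms(1) a S(2), of i]
      spine_vertex_not_between[OF assms(1) S(1) a, of j] S assms(4)
    by (cases "u \<le> i"; cases "j \<le> u") auto
qed

text \<open>If all copies were met, \<open>Inl i\<close> would separate a vertex of the first copy
  from one of the last; \<open>2 <= r\<close> makes these two copies different.\<close>

lemma copy_part_neq_all:
  assumes "mutual_visibility_set C S" and "i \<in> spine_part S" and "i < r" and "2 \<le> r"
  shows "copy_part S \<noteq> {..<r}"
proof
  assume eq: "copy_part S = {..<r}"
  have "0 \<in> copy_part S" "r - 1 \<in> copy_part S"
    using assms(4) unfolding eq by auto
  then obtain a b where "Inr (0, a) \<in> S" "Inr (r - 1, b) \<in> S"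
    by (auto simp: copy_part_def)
  moreover have "i \<le> r - 1"
    using assms(3) by simp
  ultimately show False
    using spine_vertex_not_between[OF assms(1), of "Inr (0, a)" "Inr (r - 1, b)" i] assms
    by (auto simp: spine_part_def)
qed

text \<open>Each spine vertex in \<open>S\<close> costs a copy. One is handled by
  \<open>copy_part_neq_all\<close>; two confine the copies to an open interval of
  \<open>j - i - 1 <= r - 2\<close> positions.\<close>

lemma card_parts_cases:
  assumes "mutual_visibility_set C S" and "2 \<le> r"
  obtains "card (spine_part S) = 0" "card (copy_part S) \<le> r"
  | "card (spine_part S) = 1" "card (copy_part S) \<le> r - 1"
  | "card (spine_part S) = 2" "card (copy_part S) \<le> r - 2"
proof -
  have sub: "spine_part S \<subseteq> {..<r}" "copy_part S \<subseteq> {..<r}"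
    using parts_subset assms(1) by (auto simp: mutual_visibility_set_def)
  consider "card (spine_part S) = 0" | "card (spine_part S) = 1" | "card (spine_part S) = 2"
    using spine_part_le_2[OF assms(1)] by linarith
  then show thesis
  proof cases
    case 1
    then show thesis
      using that(1) card_mono[OF _ sub(2)] by simp
  next
    case 2
    then obtain i where "i \<in> spine_part S"
      by (auto simp: card_1_singleton_iff)
    then have "copy_part S \<subset> {..<r}"
      using copy_part_neq_all[OF assms(1)] sub assms(2) by blast
    then have "card (copy_part S) < card {..<r}"
      by (intro psubset_card_mono) auto
    with 2 show thesis
      by (intro that(2)) auto
  next
    case 3
    then obtain i j where ij: "i \<in> spine_part S" "j \<in> spine_part S" "i < j"
      by (metis card_2_iff insert_iff linorder_neqE_nat)
    then have "card (copy_part S) \<le> card {i<..<j}"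
      using copy_part_between_spine[OF assms(1)] by (intro card_mono) auto
    moreover have "j < r"
      using ij sub by auto
    ultimately show thesis
      using 3 by (intro that(3)) auto
  qed
qed

text \<open>Vertices of copies at \<open>u < v\<close> are at distance \<open>v - u + 2\<close>, so
  all copies met lie within \<open>k - 1\<close> consecutive positions starting at the least
  one.\<close>

lemma card_copy_part_le:
  assumes "k_distance_mutual_visibility_set C k S" and "2 \<le> k"
  shows "card (copy_part S) \<le> k - 1"
proof (cases "copy_part S = {}")
  case False
  let ?B = "copy_part S"
  have "S \<subseteq> pverts C"
    using assms(1) by (simp add: k_distance_mutual_visibility_set_def)
  then have "finite ?B"
    using parts_subset(2) finite_subset finite_lessThan by metis
  then have Min: "Min ?B \<in> ?B" "\<And>v. v \<in> ?B \<Longrightarrow> Min ?B \<le> v"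
    using False by auto
  \<comment> \<open>The 2 counts the edges joining the two copies to the spine; for
    \<open>v = Min ?B\<close> the claim is just \<open>2 <= k\<close>.\<close>
  have "v + 2 \<le> Min ?B + k" if v: "v \<in> ?B" for v
  proof (cases "Min ?B < v")
    case True
    obtain a b where ab: "Inr (Min ?B, a) \<in> S" "Inr (v, b) \<in> S"
      using v Min(1) by (auto simp: copy_part_def)
    then have "k_visible C S k (Inr (Min ?B, a)) (Inr (v, b))"
      using assms(1) True by (auto simp: k_distance_mutual_visibility_set_def)
    then obtain p where "path_between C (Inr (Min ?B, a)) (Inr (v, b)) p" "vwalk_length p \<le> k"
      by (auto simp: k_visible_def shortest_path_def)
    then show ?thesis
      using length_spine_path_le[of "Inr (Min ?B, a)" "Inr (v, b)" p] True
      by (simp add: length_spine_path)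
  next
    case False
    then show ?thesis
      using Min(2)[OF v] assms(2) by simp
  qed
  then have "?B \<subseteq> {Min ?B..<Min ?B + (k - 1)}"
    using Min(2) by fastforce
  then have "card ?B \<le> card {Min ?B..<Min ?B + (k - 1)}"
    by (intro card_mono) auto
  then show ?thesis by simp
qed simp

section \<open>Extremal sets\<close>

text \<open>The common shape of the three extremal sets.\<close>

definition layers :: "nat set \<Rightarrow> nat set \<Rightarrow> (nat + nat \<times> 'a) set" where
  "layers A U = Inl ` A \<union> Inr ` (U \<times> pverts H)"

lemma card_layers:
  assumes "finite A" and "finite U"
  shows "card (layers A U) = card A + card U * card (pverts H)"
  using assms unfolding layers_def
  by (subst card_Un_disjoint)
    (auto simp: card_image card_cartesian_product H.pair_finite_verts)

text \<open>The bound \<open>k\<close> is tight three times: between the outermost copies,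
  \<open>(k - 2) + 2\<close>; between the two spine vertices; and from a spine vertex to the far
  copy, \<open>(k - 1) + 1\<close>. The assumption \<open>k <= r - 1\<close> makes room for
  \<open>Inl k\<close>.\<close>

lemma layers_flanked:
  assumes "2 \<le> k" and "k \<le> r - 1"
  shows "k_distance_mutual_visibility_set C k (layers {0, k} {1..<k})"
  using assms by (intro k_distance_mutual_visibility_setI) (auto simp: layers_def pverts_C)

text \<open>The same pattern for \<open>k = r\<close>, where the right flank \<open>Inl r\<close>
  would fall off the path.\<close>

lemma layers_half_flanked:
  assumes "2 \<le> r"
  shows "k_distance_mutual_visibility_set C r (layers {0} {1..<r})"
  using assms by (intro k_distance_mutual_visibility_setI) (auto simp: layers_def pverts_C)

text \<open>The first and last copies are \<open>(r - 1) + 2\<close> apart, hence the bound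
  \<open>r + 1\<close>.\<close>

lemma layers_all: "k_distance_mutual_visibility_set C (r + 1) (layers {} {..<r})"
  by (intro k_distance_mutual_visibility_setI) (auto simp: layers_def pverts_C)

section \<open>The values of \<open>mu_k\<close> and \<open>mu\<close>\<close>

lemma mu_k_path_corona:
  assumes "2 \<le> k" and "k \<le> r - 1"
  shows "mu_k k C = (k - 1) * card (pverts H) + 2"
proof (rule mu_k_eqI[OF C.pair_finite_verts layers_flanked[OF assms]])
  show "card (layers {0, k} {1..<k}) = (k - 1) * card (pverts H) + 2"
    using assms by (subst card_layers) auto
  fix S assume S: "k_distance_mutual_visibility_set C k S"
  then have "S \<subseteq> pverts C"
    by (simp add: k_distance_mutual_visibility_set_def)
  then have "card S \<le> card (spine_part S) + card (copy_part S) * card (pverts H)"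
    by (rule card_le_parts)
  \<comment> \<open>The bounds on spine vertices and on copies are estimated separately;
    \<open>layers_flanked\<close> attains both at once.\<close>
  also have "\<dots> \<le> 2 + (k - 1) * card (pverts H)"
    using S assms by (intro add_mono mult_right_mono spine_part_le_2 card_copy_part_le
        k_distance_imp_mutual_visibility_set) auto
  finally show "card S \<le> (k - 1) * card (pverts H) + 2" by simp
qed

lemma mu_r_path_corona:
  assumes "3 \<le> r" and "1 \<le> card (pverts H)"
  shows "mu_k r C = (r - 1) * card (pverts H) + 1"
proof (rule mu_k_eqI[OF C.pair_finite_verts layers_half_flanked])
  show "card (layers {0} {1..<r}) = (r - 1) * card (pverts H) + 1"
    by (subst card_layers) auto
  fix S assume S: "k_distance_mutual_visibility_set C r S"
  let ?n = "card (pverts H)"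
  have card: "card S \<le> card (spine_part S) + card (copy_part S) * ?n"
    using S by (intro card_le_parts) (simp add: k_distance_mutual_visibility_set_def)
  have "2 \<le> r"
    using assms(1) by simp
  then have split_r: "(r - 1) * ?n = (r - 2) * ?n + ?n"
    by (auto simp: le_iff_add)
  from k_distance_imp_mutual_visibility_set[OF S] \<open>2 \<le> r\<close> show "card S \<le> (r - 1) * ?n + 1"
  proof (cases rule: card_parts_cases)
    \<comment> \<open>Without spine vertices the bound \<open>r\<close> of the case is too weak; the
      distance bound leaves at most \<open>r - 1\<close> copies.\<close>
    case 1
    then show ?thesis
      using card 1(1) mult_le_mono1[OF card_copy_part_le[OF S \<open>2 \<le> r\<close>], of ?n] by linarith
  next
    case 2
    then show ?thesis
      using card 2(1) mult_le_mono1[OF 2(2), of ?n] by linarith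
  next
    \<comment> \<open>The second spine vertex is paid for by a further copy, which has at least one
      vertex.\<close>
    case 3
    then show ?thesis
      using card 3(1) mult_le_mono1[OF 3(2), of ?n] split_r assms(2) by linarith
  qed
qed (use assms in simp)

text \<open>By \<open>card_parts_cases\<close> each spine vertex is traded for a whole copy, and
  since copies are nonempty the trade never gains.\<close>

lemma card_mutual_visibility_set_le:
  assumes "2 \<le> r" and "1 \<le> card (pverts H)" and S: "mutual_visibility_set C S"
  shows "card S \<le> r * card (pverts H)"
proof -
  let ?n = "card (pverts H)"
  have card: "card S \<le> card (spine_part S) + card (copy_part S) * ?n"
    using S by (intro card_le_parts) (simp add: mutual_visibility_set_def)
  have split_r: "r * ?n = (r - 1) * ?n + ?n" "r * ?n = (r - 2) * ?n + 2 * ?n"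
    using assms(1) by (auto simp: le_iff_add add_mult_distrib)
  from S assms(1) show ?thesis
  proof (cases rule: card_parts_cases)
    case 1
    then show ?thesis
      using card 1(1) mult_le_mono1[OF 1(2), of ?n] by linarith
  next
    case 2
    then show ?thesis
      using card 2(1) mult_le_mono1[OF 2(2), of ?n] split_r assms(2) by linarith
  next
    case 3
    then show ?thesis
      using card 3(1) mult_le_mono1[OF 3(2), of ?n] split_r assms(2) by linarith
  qed
qed

end

theorem theorem4p6:
  fixes G :: "'a pair_pre_digraph" and n r :: nat
  assumes "pair_graph G"
    and "n = card (pverts G)" and "n \<ge> 2"
    and "r \<ge> 3"
  shows "(\<forall>k. 2 \<le> k \<and> k \<le> r - 1 \<longrightarrow> mu_k k (corona (path_graph r) G) = (k - 1) * n + 2)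
    \<and> mu_k r (corona (path_graph r) G) = (r - 1) * n + 1
    \<and> mu_k (r + 1) (corona (path_graph r) G) = mu (corona (path_graph r) G)
    \<and> mu (corona (path_graph r) G) = r * n"
proof -
  interpret path_corona G r
    using assms(1) by (rule path_corona.intro)
  have n: "1 \<le> card (pverts G)" and r: "2 \<le> r"
    using assms by auto
  have card: "card (layers {} {..<r}) = r * n"
    using assms(2) by (simp add: card_layers)
  have le: "card S \<le> r * n" if "mutual_visibility_set C S" for S
    using card_mutual_visibility_set_le[OF r n that] assms(2) by simp
  \<comment> \<open>The union of all copies attains both maxima, and the bound \<open>le\<close> for
    mutual-visibility sets covers both.\<close>
  have "mu_k (r + 1) C = r * n"
    by (rule mu_k_eqI[OF C.pair_finite_verts layers_all card])
      (intro le k_distance_imp_mutual_visibility_set)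
  moreover have "mu C = r * n"
    by (rule mu_eqI[OF C.pair_finite_verts k_distance_imp_mutual_visibility_set[OF layers_all] card le])
  ultimately show ?thesis
    using mu_k_path_corona mu_r_path_corona[OF assms(4) n] assms(2) by simp
qed

end
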